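(* Let $A$ be a ring with $1$, $\sigma$ a ring endomorphism of $A$, $\delta$ a $\sigma$-derivation of $A$, and $R=A[t;\sigma,\delta]$. Let $f,g\in R$ be monic polynomials, $\deg f=n>0$, such that there exist monic polynomials $h,h'\in R$ with $f=gh=h'g$ and $\deg h<n$. Let $C\subseteq A^n$ be the code determined by the left $R$-module $Rg/Rf$, and let $\underline{h}=(h_0,\dots,h_{n-1})\in A^n$ where $h(t)=\sum_{i=0}^{n-1}h_it^i$. Then the $n\times n$ matrix $H$ whose $i$-th row is $T_f^{i-1}(\underline{h})$, for $1\le i\le n$, is a control matrix of $C$, i.e. $C=\{c\in A^n : cH=0\}$.
   Context: A $\sigma$-derivation of $A$ is an additive map $\delta:A\to A$ with $\delta(ab)=\sigma(a)\delta(b)+\delta(a)b$ for all $a,b\in A$. Ring endomorphisms are unital. The skew polynomial (Ore) ring $R=A[t;\sigma,\delta]$ consists of the polynomials $\sum a_it^i$ with coefficients $a_i\in A$ written on the left, with usual addition and with multiplication determined by $ta=\sigma(a)t+\delta(a)$ for $a\in A$. Monic means leading coefficient $1$. For $f(t)=\sum_{i=0}^{n}a_it^i$ monic of degree $n$, the companion matrix $C_f\in M_n(A)$ has rows $e_2,e_3,\dots,e_n$ (standard basis row vectors) and last row $(-a_0,-a_1,\dots,-a_{n-1})$. The map $T_f:A^n\to A^n$ is $T_f(x_1,\dots,x_n)=(\sigma(x_1),\dots,\sigma(x_n))C_f+(\delta(x_1),\dots,\delta(x_n))$; elements of $A^n$ are row vectors and $A^n$ is a left $A$-module. Since $f$ is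 monic of degree $n$, every class in the left $R$-module $R/Rf$ has a unique representative $\sum_{i=0}^{n-1}c_it^i$. For a monic $g$ with $f\in Rg$, the code determined by $Rg/Rf$ is the set $C\subseteq A^n$ of coordinate vectors $(c_0,\dots,c_{n-1})$, in the basis $1,t,\dots,t^{n-1}$, of the elements of $Rg/Rf\subseteq R/Rf$. A matrix $H$ is a control matrix of a left linear code $C\subseteq A^n$ if $C$ is the left annihilator of $H$, i.e. $C=\{c\in A^n: cH=0\}$. *)

theory Defs
  imports
    "HOL-Computational_Algebra.Polynomial"
    "HOL-Library.Set_Algebras"
    "Jordan_Normal_Form.Matrix"
begin

text \<open>
  The coefficient ring \<open>A\<close> is a type of class \<open>ring_1\<close>; it need not be commutative.
\<close>

locale ring_endomorphism =
  fixes \<sigma> :: "'a::ring_1 \<Rightarrow> 'a"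
  assumes endo_add: "\<sigma> (a + b) = \<sigma> a + \<sigma> b"
    and endo_mult: "\<sigma> (a * b) = \<sigma> a * \<sigma> b"
    and endo_one: "\<sigma> 1 = 1"

locale skew_derivation =
  fixes \<sigma> \<delta> :: "'a::ring_1 \<Rightarrow> 'a"
  assumes deriv_add: "\<delta> (a + b) = \<delta> a + \<delta> b"
    and deriv_mult: "\<delta> (a * b) = \<sigma> a * \<delta> b + \<delta> a * b"

section \<open>The skew polynomial ring\<close>

text \<open>
  As a left \<open>A\<close>-module, \<open>R = A[t; \<sigma>, \<delta>]\<close> is the type \<open>'a poly\<close>, where \<open>coeff p i\<close> is the coefficient
  standing to the left of \<open>t^i\<close>. From that type only the additive structure, \<open>coeff\<close> and
  \<open>degree\<close> are used; its commutative product plays no role.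

  From \<open>t a = \<sigma>(a) t + \<delta>(a)\<close> one gets \<open>t (\<Sum>j. b\<^sub>j t^j) = \<Sum>j. \<sigma>(b\<^sub>j) t^(j+1) + \<Sum>j. \<delta>(b\<^sub>j) t^j\<close>, and
  the product of \<open>\<Sum>i. a\<^sub>i t^i\<close> with \<open>q\<close> is \<open>\<Sum>i. a\<^sub>i (t^i q)\<close>.
\<close>

definition lscale :: "'a::ring_1 \<Rightarrow> 'a poly \<Rightarrow> 'a poly" where
  "lscale a q = map_poly (\<lambda>b. a * b) q"

definition ore_shift :: "('a::ring_1 \<Rightarrow> 'a) \<Rightarrow> ('a \<Rightarrow> 'a) \<Rightarrow> 'a poly \<Rightarrow> 'a poly" where
  "ore_shift \<sigma> \<delta> q = pCons 0 (map_poly \<sigma> q) + map_poly \<delta> q"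

definition ore_mult :: "('a::ring_1 \<Rightarrow> 'a) \<Rightarrow> ('a \<Rightarrow> 'a) \<Rightarrow> 'a poly \<Rightarrow> 'a poly \<Rightarrow> 'a poly" where
  "ore_mult \<sigma> \<delta> p q = (\<Sum>i\<le>degree p. lscale (coeff p i) ((ore_shift \<sigma> \<delta> ^^ i) q))"

text \<open>The lemmas below confirm that this is the Ore extension: a unital ring in which
  \<open>t a = \<sigma>(a) t + \<delta>(a)\<close> and in which \<open>a\<^sub>i t^i\<close> is literally a product.\<close>

lemma coeff_lscale [simp]: "coeff (lscale a q) n = a * coeff q n"
  by (simp add: lscale_def coeff_map_poly)

lemma lscale_add: "lscale a (p + q) = lscale a p + lscale a q"
  and lscale_add_left: "lscale (a + b) p = lscale a p + lscale b p"
  and lscale_0_left [simp]: "lscale 0 p = 0"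
  and lscale_0 [simp]: "lscale a 0 = 0"
  and lscale_1 [simp]: "lscale 1 p = p"
  and lscale_lscale: "lscale a (lscale b p) = lscale (a * b) p"
  by (simp_all add: poly_eq_iff algebra_simps)

lemma lscale_sum: "lscale a (sum f I) = (\<Sum>i\<in>I. lscale a (f i))"
  by (induction I rule: infinite_finite_induct) (simp_all add: lscale_add)

lemma poly_eq_sum_lscale: "p = (\<Sum>i\<le>degree p. lscale (coeff p i) (monom 1 i))"
proof (rule poly_eqI)
  fix n
  have "coeff (\<Sum>i\<le>degree p. lscale (coeff p i) (monom 1 i)) n
      = (\<Sum>i\<le>degree p. if i = n then coeff p i else 0)"
    by (simp add: coeff_sum if_distrib cong: if_cong)
  also have "\<dots> = coeff p n"
    by (simp add: coeff_eq_0)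
  finally show "coeff p n = coeff (\<Sum>i\<le>degree p. lscale (coeff p i) (monom 1 i)) n" ..
qed

locale ore_extension = ring_endomorphism \<sigma> + skew_derivation \<sigma> \<delta>
  for \<sigma> \<delta> :: "'a::ring_1 \<Rightarrow> 'a"
begin

abbreviation mult (infixl "\<star>" 70) where "mult \<equiv> ore_mult \<sigma> \<delta>"

abbreviation "shift \<equiv> ore_shift \<sigma> \<delta>"

lemma endo_0 [simp]: "\<sigma> 0 = 0" and deriv_0 [simp]: "\<delta> 0 = 0"
  using endo_add[of 0 0] deriv_add[of 0 0] by simp_all

lemma deriv_1 [simp]: "\<delta> 1 = 0"
  using deriv_mult[of 1 1] by (simp add: endo_one)

lemma coeff_shift:
  "coeff (shift q) n = (case n of 0 \<Rightarrow> 0 | Suc m \<Rightarrow> \<sigma> (coeff q m)) + \<delta> (coeff q n)"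
  by (simp add: ore_shift_def coeff_map_poly coeff_pCons split: nat.split)

lemma shift_add: "shift (p + q) = shift p + shift q"
  by (simp add: poly_eq_iff coeff_shift endo_add deriv_add split: nat.split)

lemma shift_0 [simp]: "shift 0 = 0"
  by (simp add: poly_eq_iff coeff_shift split: nat.split)

lemma shift_lscale: "shift (lscale a q) = lscale (\<sigma> a) (shift q) + lscale (\<delta> a) q"
  by (simp add: poly_eq_iff coeff_shift endo_mult deriv_mult algebra_simps split: nat.split)

lemma shift_monom: "shift (monom 1 i) = monom 1 (Suc i)"
  by (auto simp: poly_eq_iff coeff_shift endo_one split: nat.split)

lemma shift_pow_add: "(shift ^^ i) (p + q) = (shift ^^ i) p + (shift ^^ i) q"
  by (induction i) (simp_all add: shift_add)

lemma shift_pow_0 [simp]: "(shift ^^ i) 0 = 0"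
  by (induction i) simp_all

lemma shift_sum: "shift (sum f I) = (\<Sum>i\<in>I. shift (f i))"
  by (induction I rule: infinite_finite_induct) (simp_all add: shift_add)

lemma shift_pow_monom: "(shift ^^ i) (monom 1 j) = monom 1 (i + j)"
  by (induction i) (simp_all add: shift_monom)

lemma mult_eq_sum:
  assumes "degree p \<le> N"
  shows "p \<star> q = (\<Sum>i\<le>N. lscale (coeff p i) ((shift ^^ i) q))"
  unfolding ore_mult_def
  by (rule sum.mono_neutral_left) (use assms in \<open>auto simp: coeff_eq_0\<close>)

lemma mult_0_left: "0 \<star> q = 0"
  by (simp add: ore_mult_def)

lemma mult_add_right: "p \<star> (q + r) = p \<star> q + p \<star> r"
  by (simp add: ore_mult_def shift_pow_add lscale_add sum.distrib)

lemma mult_add_left: "(p + q) \<star> r = p \<star> r + q \<star> r"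
proof -
  define N where "N = max (degree p) (degree q)"
  have "degree p \<le> N" "degree q \<le> N" "degree (p + q) \<le> N"
    by (auto simp: N_def intro: degree_add_le)
  then show ?thesis
    by (simp add: mult_eq_sum lscale_add_left sum.distrib)
qed

lemma mult_sum_left: "sum f I \<star> r = (\<Sum>i\<in>I. f i \<star> r)"
  by (induction I rule: infinite_finite_induct) (simp_all add: mult_add_left mult_0_left)

lemma lscale_mult: "lscale a p \<star> q = lscale a (p \<star> q)"
proof -
  have "degree (lscale a p) \<le> degree p"
    by (rule degree_le) (simp add: coeff_eq_0)
  then show ?thesis
    by (simp add: mult_eq_sum[of _ "degree p"] lscale_sum lscale_lscale)
qed

lemma monom_mult: "monom 1 i \<star> q = (shift ^^ i) q"
proof -
  have "monom 1 i \<star> q = (\<Sum>j\<le>i. if j = i then (shift ^^ j) q else 0)"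
    unfolding mult_eq_sum[OF degree_monom_le] by (rule sum.cong) auto
  then show ?thesis by simp
qed

lemma shift_mult: "shift p \<star> q = shift (p \<star> q)"
proof -
  let ?m = "\<lambda>i. monom (1::'a) i"
  have "shift p \<star> q = (\<Sum>i\<le>degree p. shift (lscale (coeff p i) (?m i)) \<star> q)"
    by (subst poly_eq_sum_lscale) (simp only: shift_sum mult_sum_left)
  also have "\<dots> = (\<Sum>i\<le>degree p. shift (lscale (coeff p i) ((shift ^^ i) q)))"
    by (simp add: shift_lscale shift_monom mult_add_left lscale_mult monom_mult)
  also have "\<dots> = shift (p \<star> q)"
    by (simp add: ore_mult_def shift_sum)
  finally show ?thesis .
qed

lemma shift_pow_mult: "(shift ^^ i) p \<star> q = (shift ^^ i) (p \<star> q)"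
  by (induction i) (simp_all add: shift_mult)

lemma mult_assoc: "(p \<star> q) \<star> r = p \<star> (q \<star> r)"
  by (simp add: ore_mult_def[of _ _ p] mult_sum_left lscale_mult shift_pow_mult)

lemma mult_1_left: "[:1:] \<star> p = p"
  by (simp add: ore_mult_def)

lemma mult_1_right: "p \<star> [:1:] = p"
  using poly_eq_sum_lscale[of p] shift_pow_monom[of _ 0]
  by (simp add: ore_mult_def flip: monom_0)

lemma const_mult: "[:a:] \<star> q = lscale a q"
  by (simp add: ore_mult_def)

lemma const_mult_monom: "[:a:] \<star> monom 1 i = monom a i"
  by (simp add: const_mult poly_eq_iff)

lemma t_mult_const: "[:0, 1:] \<star> [:a:] = [:\<sigma> a:] \<star> [:0, 1:] + [:\<delta> a:]"
  using monom_mult[of 1 "[:a:]"]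
  by (simp add: const_mult monom_altdef monom_Suc monom_0 poly_eq_iff coeff_shift coeff_pCons
      split: nat.split)

end

section \<open>Codes\<close>

definition left_multiples ::
    "('a::ring_1 \<Rightarrow> 'a) \<Rightarrow> ('a \<Rightarrow> 'a) \<Rightarrow> 'a poly \<Rightarrow> 'a poly set" where
  "left_multiples \<sigma> \<delta> g = {ore_mult \<sigma> \<delta> p g | p. True}"

text \<open>Residue classes modulo \<open>Rf\<close> are the cosets \<open>p +o Rf\<close>; \<open>left_quotient \<sigma> \<delta> g f\<close> is \<open>Rg/Rf\<close> as a
  set of such classes.\<close>

definition left_quotient ::
    "('a::ring_1 \<Rightarrow> 'a) \<Rightarrow> ('a \<Rightarrow> 'a) \<Rightarrow> 'a poly \<Rightarrow> 'a poly \<Rightarrow> 'a poly set set" where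
  "left_quotient \<sigma> \<delta> g f = (\<lambda>p. p +o left_multiples \<sigma> \<delta> f) ` left_multiples \<sigma> \<delta> g"

definition poly_of_coords :: "'a::ring_1 vec \<Rightarrow> 'a poly" where
  "poly_of_coords c = (\<Sum>i<dim_vec c. monom (c $ i) i)"

definition skew_code ::
    "('a::ring_1 \<Rightarrow> 'a) \<Rightarrow> ('a \<Rightarrow> 'a) \<Rightarrow> 'a poly \<Rightarrow> 'a poly \<Rightarrow> 'a vec set" where
  "skew_code \<sigma> \<delta> g f = {c \<in> carrier_vec (degree f).
     poly_of_coords c +o left_multiples \<sigma> \<delta> f \<in> left_quotient \<sigma> \<delta> g f}"

text \<open>Elements of \<open>A^n\<close> are row vectors, with coordinates indexed from 0. The entries of the vector
  stand on the left in the products, which matters over a noncommutative ring.\<close>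

definition vec_mult_mat :: "'a::ring_1 vec \<Rightarrow> 'a mat \<Rightarrow> 'a vec" (infixl "\<^sub>v*" 70) where
  "c \<^sub>v* M = vec (dim_col M) (\<lambda>j. c \<bullet> col M j)"

definition companion :: "'a::ring_1 poly \<Rightarrow> 'a mat" where
  "companion f = (let n = degree f in
     mat n n (\<lambda>(i, j). if i + 1 < n then (if j = i + 1 then 1 else 0) else - coeff f j))"

definition pseudo_linear_map ::
    "('a::ring_1 \<Rightarrow> 'a) \<Rightarrow> ('a \<Rightarrow> 'a) \<Rightarrow> 'a poly \<Rightarrow> 'a vec \<Rightarrow> 'a vec" where
  "pseudo_linear_map \<sigma> \<delta> f x = map_vec \<sigma> x \<^sub>v* companion f + map_vec \<delta> x"

definition left_annihilator :: "'a::ring_1 mat \<Rightarrow> 'a vec set" where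
  "left_annihilator H = {c \<in> carrier_vec (dim_row H). c \<^sub>v* H = 0\<^sub>v (dim_col H)}"

definition control_matrix :: "'a::ring_1 mat \<Rightarrow> 'a vec set \<Rightarrow> bool" where
  "control_matrix H C \<longleftrightarrow> C = left_annihilator H"

end

theory Submission
  imports Defs
begin

text \<open>
  Coordinate vectors represent classes in \<open>R/Rf\<close>, and \<open>T\<^sub>f\<close> is left multiplication by \<open>t\<close> there, so
  \<open>c H\<close> represents the class of \<open>c h\<close>. Hence \<open>c H = 0\<close> iff \<open>c h \<in> Rf = Rgh\<close>, and since the monic
  \<open>h\<close> is right cancellable this means \<open>c \<in> Rg\<close>. As \<open>Rf \<subseteq> Rg\<close>, that is membership in the code.
\<close>

section \<open>Coordinate vectors as polynomials of bounded degree\<close>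

lemma coeff_poly_of_coords:
  "coeff (poly_of_coords c) j = (if j < dim_vec c then c $ j else 0)"
  by (simp add: poly_of_coords_def coeff_sum)

text \<open>The zero polynomial also has degree 0, so the strict bound needs at least one
  coordinate.\<close>

lemma degree_poly_of_coords:
  assumes "dim_vec c > 0"
  shows "degree (poly_of_coords c) < dim_vec c"
proof -
  have "degree (poly_of_coords c) \<le> dim_vec c - 1"
    by (rule degree_le) (auto simp: coeff_poly_of_coords)
  with assms show ?thesis by simp
qed

lemma poly_of_coords_coeff:
  assumes "degree p < n"
  shows "poly_of_coords (vec n (coeff p)) = p"
  using assms by (auto simp: poly_eq_iff coeff_poly_of_coords coeff_eq_0)

lemma poly_of_coords_eq_0_iff: "poly_of_coords c = 0 \<longleftrightarrow> c = 0\<^sub>v (dim_vec c)"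
proof
  assume "poly_of_coords c = 0"
  then have "c $ i = 0" if "i < dim_vec c" for i
    using that coeff_poly_of_coords[of c i] by simp
  then show "c = 0\<^sub>v (dim_vec c)"
    by (intro eq_vecI) simp_all
next
  assume c: "c = 0\<^sub>v (dim_vec c)"
  have "coeff (poly_of_coords c) j = 0" for j
    unfolding coeff_poly_of_coords by (subst (2) c) simp
  then show "poly_of_coords c = 0"
    by (simp add: poly_eq_iff)
qed

text \<open>Left \<open>A\<close>-linearity of the identification with polynomials: entries of
  \<open>c\<close> stay on the left in \<open>\<^sub>v*\<close> just as in
  \<open>lscale\<close>.\<close>

lemma poly_of_coords_vec_mult_mat:
  assumes "dim_vec c = dim_row M"
  shows "poly_of_coords (c \<^sub>v* M)
    = (\<Sum>i<dim_vec c. lscale (c $ i) (poly_of_coords (row M i)))"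
proof (rule poly_eqI)
  fix j
  show "coeff (poly_of_coords (c \<^sub>v* M)) j
      = coeff (\<Sum>i<dim_vec c. lscale (c $ i) (poly_of_coords (row M i))) j"
    using assms
    by (simp add: coeff_poly_of_coords coeff_sum vec_mult_mat_def scalar_prod_def
        atLeast0LessThan)
qed

lemma pseudo_linear_map_carrier [simp]:
  "x \<in> carrier_vec n \<Longrightarrow> pseudo_linear_map \<sigma> \<delta> f x \<in> carrier_vec n"
  by (rule carrier_vecI) (simp add: pseudo_linear_map_def)

lemma pseudo_linear_map_pow_carrier [simp]:
  "x \<in> carrier_vec n \<Longrightarrow> (pseudo_linear_map \<sigma> \<delta> f ^^ i) x \<in> carrier_vec n"
  by (induction i) simp_all

lemma lscale_diff: "lscale a (p - q) = lscale a p - lscale a q"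
  by (simp add: poly_eq_iff algebra_simps)

context ore_extension
begin

section \<open>Leading coefficients and products with a monic right factor\<close>

lemma mult_minus_left: "(- p) \<star> q = - (p \<star> q)"
  using mult_add_left[of p "- p" q] by (simp add: mult_0_left eq_neg_iff_add_eq_0 add.commute)

lemma mult_diff_left: "(p - q) \<star> r = p \<star> r - q \<star> r"
  using mult_add_left[of p "- q" r] by (simp add: mult_minus_left)

lemma shift_diff: "shift (p - q) = shift p - shift q"
  using shift_add[of "p - q" q] by (simp add: algebra_simps)

lemma endo_pow_1 [simp]: "(\<sigma> ^^ i) 1 = 1"
  by (induction i) (simp_all add: endo_one)

lemma coeff_shift_pow_eq_0: "degree q + i < k \<Longrightarrow> coeff ((shift ^^ i) q) k = 0"
  by (induction i arbitrary: k) (auto simp: coeff_eq_0 coeff_shift split: nat.split)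

text \<open>In the top position only the \<open>\<sigma>\<close> part of \<open>shift\<close>
  arrives; the \<open>\<delta>\<close> part acts on a coefficient that is still zero.\<close>

lemma coeff_shift_pow_top: "coeff ((shift ^^ i) q) (degree q + i) = (\<sigma> ^^ i) (lead_coeff q)"
  by (induction i) (auto simp: coeff_shift coeff_shift_pow_eq_0)

text \<open>Only the summand \<open>i = degree p\<close> reaches this position, and there the
  leading \<open>1\<close> of \<open>q\<close> survives because \<open>\<sigma>\<close> is
  unital.\<close>

lemma coeff_mult_monic_top:
  assumes "lead_coeff q = 1"
  shows "coeff (p \<star> q) (degree q + degree p) = lead_coeff p"
proof -
  have "coeff (p \<star> q) (degree q + degree p)
      = (\<Sum>i\<le>degree p. if i = degree p then lead_coeff p else 0)"
    unfolding ore_mult_def coeff_sum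
    by (rule sum.cong) (auto simp: coeff_shift_pow_top assms coeff_shift_pow_eq_0)
  then show ?thesis by simp
qed

text \<open>The disjunct \<open>p \<star> q = 0\<close> is separate because for \<open>q\<close> of
  degree 0 a zero product does not have smaller degree than \<open>q\<close>.\<close>

lemma mult_monic_low_degree:
  assumes "lead_coeff q = 1" and "p \<star> q = 0 \<or> degree (p \<star> q) < degree q"
  shows "p = 0"
proof -
  have "coeff (p \<star> q) (degree q + degree p) = 0"
    using assms(2) by (auto intro: coeff_eq_0)
  then show ?thesis
    using coeff_mult_monic_top[OF assms(1), of p] by simp
qed

section \<open>Left ideals \<open>Rq\<close> and cosets modulo \<open>Rf\<close>\<close>

lemma left_multiples_iff: "p \<in> left_multiples \<sigma> \<delta> q \<longleftrightarrow> (\<exists>r. p = r \<star> q)"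
  by (simp add: left_multiples_def)

lemma left_multiples_0: "0 \<in> left_multiples \<sigma> \<delta> q"
  using mult_0_left[of q] unfolding left_multiples_iff by metis

lemma left_multiples_add:
  "p \<in> left_multiples \<sigma> \<delta> q \<Longrightarrow> r \<in> left_multiples \<sigma> \<delta> q \<Longrightarrow> p + r \<in> left_multiples \<sigma> \<delta> q"
  unfolding left_multiples_iff by (metis mult_add_left)

lemma left_multiples_diff:
  "p \<in> left_multiples \<sigma> \<delta> q \<Longrightarrow> r \<in> left_multiples \<sigma> \<delta> q \<Longrightarrow> p - r \<in> left_multiples \<sigma> \<delta> q"
  unfolding left_multiples_iff by (metis mult_diff_left)

lemma left_multiples_lscale:
  "p \<in> left_multiples \<sigma> \<delta> q \<Longrightarrow> lscale a p \<in> left_multiples \<sigma> \<delta> q"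
  unfolding left_multiples_iff by (metis lscale_mult)

lemma left_multiples_shift:
  "p \<in> left_multiples \<sigma> \<delta> q \<Longrightarrow> shift p \<in> left_multiples \<sigma> \<delta> q"
  unfolding left_multiples_iff by (metis shift_mult)

lemma left_multiples_sum:
  "(\<And>i. i \<in> I \<Longrightarrow> u i \<in> left_multiples \<sigma> \<delta> q) \<Longrightarrow> sum u I \<in> left_multiples \<sigma> \<delta> q"
  by (induction I rule: infinite_finite_induct) (auto intro: left_multiples_0 left_multiples_add)

lemma left_multiples_right_cancel:
  assumes "lead_coeff h = 1"
  shows "c \<star> h \<in> left_multiples \<sigma> \<delta> (g \<star> h) \<longleftrightarrow> c \<in> left_multiples \<sigma> \<delta> g"
proof
  assume "c \<star> h \<in> left_multiples \<sigma> \<delta> (g \<star> h)"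
  then obtain p where "c \<star> h = p \<star> (g \<star> h)"
    unfolding left_multiples_iff by blast
  then have "(c - p \<star> g) \<star> h = 0"
    by (simp add: mult_diff_left mult_assoc)
  then have "c - p \<star> g = 0"
    using mult_monic_low_degree[OF assms] by blast
  then show "c \<in> left_multiples \<sigma> \<delta> g"
    unfolding left_multiples_iff by auto
next
  assume "c \<in> left_multiples \<sigma> \<delta> g"
  then show "c \<star> h \<in> left_multiples \<sigma> \<delta> (g \<star> h)"
    unfolding left_multiples_iff using mult_assoc by metis
qed

text \<open>Uniqueness of representatives: a nonzero left multiple of the monic \<open>f\<close> has
  degree at least \<open>degree f\<close>, out of reach of a coordinate polynomial.\<close>

lemma poly_of_coords_in_left_multiples_iff:
  assumes "lead_coeff f = 1" and "dim_vec c = degree f" and "degree f > 0"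
  shows "poly_of_coords c \<in> left_multiples \<sigma> \<delta> f \<longleftrightarrow> c = 0\<^sub>v (degree f)"
proof
  assume "poly_of_coords c \<in> left_multiples \<sigma> \<delta> f"
  then obtain p where p: "poly_of_coords c = p \<star> f"
    unfolding left_multiples_iff by blast
  then have "degree (p \<star> f) < degree f"
    using degree_poly_of_coords[of c] assms by simp
  then have "p = 0"
    using mult_monic_low_degree assms(1) by blast
  then show "c = 0\<^sub>v (degree f)"
    using p assms(2) poly_of_coords_eq_0_iff[of c] by (simp add: mult_0_left)
next
  assume "c = 0\<^sub>v (degree f)"
  then have "poly_of_coords c = 0"
    using assms(2) by (simp add: poly_of_coords_eq_0_iff)
  then show "poly_of_coords c \<in> left_multiples \<sigma> \<delta> f"
    by (simp add: left_multiples_0)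
qed

text \<open>Since \<open>Rf\<close> lies in \<open>Rg\<close>, the ideal \<open>Rg\<close> is a
  union of cosets of \<open>Rf\<close>, so any representative decides membership.\<close>

lemma left_quotient_coset_iff:
  assumes "f \<in> left_multiples \<sigma> \<delta> g"
  shows "p +o left_multiples \<sigma> \<delta> f \<in> left_quotient \<sigma> \<delta> g f \<longleftrightarrow> p \<in> left_multiples \<sigma> \<delta> g"
proof
  assume "p +o left_multiples \<sigma> \<delta> f \<in> left_quotient \<sigma> \<delta> g f"
  then obtain q where q: "q \<in> left_multiples \<sigma> \<delta> g"
    and eq: "p +o left_multiples \<sigma> \<delta> f = q +o left_multiples \<sigma> \<delta> f"
    unfolding left_quotient_def by blast
  have "p \<in> p +o left_multiples \<sigma> \<delta> f"
    using set_plus_intro2[OF left_multiples_0] by fastforce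
  then have "p \<in> q +o left_multiples \<sigma> \<delta> f"
    by (simp only: eq)
  then obtain r where "p = q + r" and "r \<in> left_multiples \<sigma> \<delta> f"
    unfolding elt_set_plus_def by blast
  moreover from this assms have "r \<in> left_multiples \<sigma> \<delta> g"
    unfolding left_multiples_iff using mult_assoc by metis
  ultimately show "p \<in> left_multiples \<sigma> \<delta> g"
    using q by (simp add: left_multiples_add)
qed (simp add: left_quotient_def)

section \<open>The map \<open>T_f\<close> as multiplication by \<open>t\<close> modulo
  \<open>Rf\<close>\<close>

text \<open>One reduction step modulo \<open>f\<close>: the leading term of \<open>t x\<close> is cancelled by a multiple of \<open>f\<close>.\<close>

lemma poly_of_coords_pseudo_linear_map:
  assumes "lead_coeff f = 1" and "degree f = Suc m" and "x \<in> carrier_vec (Suc m)"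
  shows "poly_of_coords (pseudo_linear_map \<sigma> \<delta> f x)
    = shift (poly_of_coords x) - lscale (\<sigma> (x $ m)) f"
proof (rule poly_eqI)
  fix j
  have x: "dim_vec x = Suc m" using assms(3) by simp
  show "coeff (poly_of_coords (pseudo_linear_map \<sigma> \<delta> f x)) j
      = coeff (shift (poly_of_coords x) - lscale (\<sigma> (x $ m)) f) j"
  proof (cases "j < Suc m")
    case True
    have "pseudo_linear_map \<sigma> \<delta> f x $ j
        = (\<Sum>k<Suc m. \<sigma> (x $ k) * (companion f $$ (k, j))) + \<delta> (x $ j)"
      using True x assms(2)
      by (simp add: pseudo_linear_map_def vec_mult_mat_def scalar_prod_def companion_def
          atLeast0LessThan)
    \<comment> \<open>The rows \<open>k < m\<close> of the companion matrix move each coordinate up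
      by one; the last row, \<open>k = m\<close>, gives the multiple of \<open>f\<close>.\<close>
    also have "(\<Sum>k<Suc m. \<sigma> (x $ k) * (companion f $$ (k, j)))
        = (\<Sum>k<m. if j = Suc k then \<sigma> (x $ k) else 0) - \<sigma> (x $ m) * coeff f j"
      using True assms(2) by (auto simp: companion_def intro!: sum.cong)
    also have "(\<Sum>k<m. if j = Suc k then \<sigma> (x $ k) else 0)
        = (case j of 0 \<Rightarrow> 0 | Suc k \<Rightarrow> \<sigma> (x $ k))"
      using True by (auto split: nat.split)
    finally show ?thesis
      using True x pseudo_linear_map_carrier[OF assms(3), of \<sigma> \<delta> f]
      by (auto simp: coeff_poly_of_coords coeff_shift split: nat.split)
  next
    case False
    \<comment> \<open>At \<open>j = Suc m\<close> the top coefficient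
      \<open>\<sigma> (x $ m)\<close> of the shift cancels, \<open>f\<close> being monic; beyond
      that all terms vanish.\<close>
    then consider "j = Suc m" | "j > Suc m" by linarith
    then show ?thesis
      using x assms(1,2) pseudo_linear_map_carrier[OF assms(3), of \<sigma> \<delta> f]
      by cases (auto simp: coeff_poly_of_coords coeff_shift coeff_eq_0 split: nat.split)
  qed
qed

text \<open>The reduction errors never leave \<open>Rf\<close>, because a left ideal is stable under
  left multiplication by \<open>t\<close> and by constants.\<close>

lemma poly_of_coords_pseudo_linear_map_pow:
  assumes "lead_coeff f = 1" and "degree f = n" and "n > 0" and "x \<in> carrier_vec n"
  shows "poly_of_coords ((pseudo_linear_map \<sigma> \<delta> f ^^ i) x) - (shift ^^ i) (poly_of_coords x)
    \<in> left_multiples \<sigma> \<delta> f"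
proof (induction i)
  case 0
  show ?case by (simp add: left_multiples_0)
next
  case (Suc i)
  obtain m where m: "n = Suc m" using assms(3) by (cases n) auto
  define y where "y = (pseudo_linear_map \<sigma> \<delta> f ^^ i) x"
  have y: "y \<in> carrier_vec (Suc m)"
    using assms(4) by (simp add: y_def m)
  \<comment> \<open>The new error is \<open>t\<close> times the old one, minus one more left
    multiple of \<open>f\<close>.\<close>
  have "poly_of_coords (pseudo_linear_map \<sigma> \<delta> f y) - (shift ^^ Suc i) (poly_of_coords x)
      = shift (poly_of_coords y - (shift ^^ i) (poly_of_coords x)) - lscale (\<sigma> (y $ m)) f"
    using poly_of_coords_pseudo_linear_map[OF assms(1) _ y] assms(2)
    by (simp add: m shift_diff)
  moreover have "f \<in> left_multiples \<sigma> \<delta> f"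
    unfolding left_multiples_iff using mult_1_left by metis
  ultimately show ?case
    using Suc.IH
    by (simp add: y_def left_multiples_diff left_multiples_shift left_multiples_lscale)
qed

text \<open>Both products are combinations with the same left coefficients \<open>c $ i\<close>, of
  \<open>T_f^i x\<close> and of \<open>t^i x\<close>, which agree modulo \<open>Rf\<close> term by
  term.\<close>

lemma poly_of_coords_orbit_matrix:
  assumes "lead_coeff f = 1" and "degree f = n" and "n > 0"
    and "x \<in> carrier_vec n" and "c \<in> carrier_vec n"
  defines "H \<equiv> mat_of_rows n (map (\<lambda>i. (pseudo_linear_map \<sigma> \<delta> f ^^ i) x) [0..<n])"
  shows "poly_of_coords (c \<^sub>v* H) - poly_of_coords c \<star> poly_of_coords x \<in> left_multiples \<sigma> \<delta> f"
proof -
  have row: "row H i = (pseudo_linear_map \<sigma> \<delta> f ^^ i) x" if "i < n" for i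
    using that assms(4) by (simp add: H_def)
  have c: "dim_vec c = n" using assms(5) by simp
  have H: "dim_row H = n" by (simp add: H_def)
  have "poly_of_coords (c \<^sub>v* H)
      = (\<Sum>i<n. lscale (c $ i) (poly_of_coords ((pseudo_linear_map \<sigma> \<delta> f ^^ i) x)))"
    using poly_of_coords_vec_mult_mat[of c H] by (simp add: c H row)
  moreover have "poly_of_coords c \<star> poly_of_coords x
      = (\<Sum>i<n. lscale (c $ i) ((shift ^^ i) (poly_of_coords x)))"
  proof -
    have n: "{..n - Suc 0} = {..<n}" using assms(3) by auto
    \<comment> \<open>The product is expanded up to \<open>n - 1\<close> rather than the actual
      degree, so that both sums have the same range; the extra terms are zero.\<close>
    have "degree (poly_of_coords c) \<le> n - 1"
      using degree_poly_of_coords[of c] c assms(3) by simp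
    from mult_eq_sum[OF this] show ?thesis
      by (simp add: n coeff_poly_of_coords c)
  qed
  ultimately have "poly_of_coords (c \<^sub>v* H) - poly_of_coords c \<star> poly_of_coords x
      = (\<Sum>i<n. lscale (c $ i) (poly_of_coords ((pseudo_linear_map \<sigma> \<delta> f ^^ i) x)
          - (shift ^^ i) (poly_of_coords x)))"
    by (simp add: lscale_diff sum_subtractf)
  then show ?thesis
    using poly_of_coords_pseudo_linear_map_pow[OF assms(1-4)]
    by (simp add: left_multiples_sum left_multiples_lscale)
qed

end

theorem corollary3p8:
  fixes \<sigma> \<delta> :: "'a::ring_1 \<Rightarrow> 'a"
    and f g h h' :: "'a poly"
    and n :: nat
  assumes "ring_endomorphism \<sigma>"
    and "skew_derivation \<sigma> \<delta>"
    and "lead_coeff f = 1" and "lead_coeff g = 1"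
    and "degree f = n" and "n > 0"
    and "lead_coeff h = 1" and "lead_coeff h' = 1"
    and "f = ore_mult \<sigma> \<delta> g h" and "f = ore_mult \<sigma> \<delta> h' g"
    and "degree h < n"
  shows "control_matrix
    (mat_of_rows n (map (\<lambda>i. (pseudo_linear_map \<sigma> \<delta> f ^^ i) (vec n (coeff h))) [0..<n]))
    (skew_code \<sigma> \<delta> g f)"
proof -
  interpret ore_extension \<sigma> \<delta>
    using assms(1,2) by (simp add: ore_extension_def)
  let ?R = "left_multiples \<sigma> \<delta>"
  define H where
    "H = mat_of_rows n (map (\<lambda>i. (pseudo_linear_map \<sigma> \<delta> f ^^ i) (vec n (coeff h))) [0..<n])"
  have dim: "dim_row H = n" "dim_col H = n"
    by (simp_all add: H_def)
  \<comment> \<open>The factorization through \<open>h'\<close> makes \<open>Rg/Rf\<close>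
    meaningful; the one through \<open>h\<close> enters later, in the cancellation.\<close>
  have "f \<in> ?R g"
    using assms(10) left_multiples_iff by blast
  then have code: "skew_code \<sigma> \<delta> g f = {c \<in> carrier_vec n. poly_of_coords c \<in> ?R g}"
    by (simp add: skew_code_def left_quotient_coset_iff assms(5))
  have "c \<^sub>v* H = 0\<^sub>v n \<longleftrightarrow> poly_of_coords c \<in> ?R g" if c: "c \<in> carrier_vec n" for c
  proof -
    have diff: "poly_of_coords (c \<^sub>v* H) - poly_of_coords c \<star> h \<in> ?R f"
      using poly_of_coords_orbit_matrix[OF assms(3,5,6) vec_carrier c, of "coeff h"]
      by (simp add: H_def poly_of_coords_coeff assms(11))
    have "c \<^sub>v* H = 0\<^sub>v n \<longleftrightarrow> poly_of_coords (c \<^sub>v* H) \<in> ?R f"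
      using poly_of_coords_in_left_multiples_iff[of f "c \<^sub>v* H"] assms(3,5,6) dim
      by (simp add: vec_mult_mat_def)
    \<comment> \<open>Two elements whose difference lies in \<open>Rf\<close> belong to
      \<open>Rf\<close> simultaneously.\<close>
    also have "\<dots> \<longleftrightarrow> poly_of_coords c \<star> h \<in> ?R f"
      using left_multiples_add[OF diff] left_multiples_diff[OF _ diff] by fastforce
    also have "\<dots> \<longleftrightarrow> poly_of_coords c \<in> ?R g"
      using left_multiples_right_cancel[OF assms(7)] assms(9) by simp
    finally show ?thesis .
  qed
  then show ?thesis
    unfolding control_matrix_def H_def[symmetric] left_annihilator_def code dim by blast
qed

end
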